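(* Let $\{X_t\}_{t\in\mathbb{Z}}$ be a zero-mean causal and invertible weakly stationary process, with AR($\infty$) representation $X_t=\pi_1X_{t-1}+\pi_2X_{t-2}+\cdots+\epsilon_t$, $\sum_{i=1}^\infty|\pi_i|<\infty$, and MA($\infty$) representation $X_t=\epsilon_t+\psi_1\epsilon_{t-1}+\psi_2\epsilon_{t-2}+\cdots$, $\sum_{i=1}^\infty|\psi_i|<\infty$ (for all $t\in\mathbb{Z}$, with the same real coefficients for all $t$), where $\{\epsilon_t\}_{t\in\mathbb{Z}}$ is white noise with variance $\sigma_\epsilon^2>0$. For $n\ge 1$ let $\phi_{nn}$ be the $n$-th partial autocorrelation coefficient of $\{X_t\}$. Then $$\limsup_{n\rightarrow\infty}|\phi_{nn}|^{1/n}=\limsup_{n\rightarrow\infty}|\pi_n|^{1/n}.$$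
   Context: All random variables are real-valued with finite second moments. Weakly stationary with zero mean means $E(X_t)=0$ and $E(X_tX_{t+k})=\gamma_k$ depends only on $k$ (so $\gamma_k=\gamma_{-k}$). White noise with variance $\sigma_\epsilon^2$ means $E(\epsilon_t)=0$, $E(\epsilon_t^2)=\sigma_\epsilon^2$, and $E(\epsilon_s\epsilon_t)=0$ for $s\neq t$. The infinite sums in the representations converge in mean square. "Causal and invertible" means that the process has both of the stated representations, with absolutely summable coefficients and the same noise $\{\epsilon_t\}$. Let $H$ be the Hilbert space (closed linear span in $L^2$) spanned by $\{X_t\}_{t\in\mathbb{Z}}$. For $I\subset\mathbb{Z}$, let $P_I$ be the orthogonal projector of $H$ onto the closed subspace $H_I$ spanned by $\{X_t\}_{t\in I}$; here $[a,b]$ denotes the set of integers from $a$ to $b$. The $k$-th partial autocorrelation coefficient ($k\ge1$) is $\phi_{kk}$, the coefficient of $X_{t-k}$ in $$P_{[t-k,t-1]}X_t=\phi_{k1}X_{t-1}+\cdots+\phi_{kk}X_{t-k};$$ by stationarity these coefficients do not depend on $t$. *)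

theory Defs
  imports "HOL-Probability.Probability"
begin

(* Elements of L2 are represented by square-integrable functions, not by their
   almost-everywhere equivalence classes. *)
definition L2 :: "'a measure \<Rightarrow> ('a \<Rightarrow> real) set" where
  "L2 M = {Y \<in> borel_measurable M. integrable M (\<lambda>\<omega>. (Y \<omega>)\<^sup>2)}"

(* Convergence in mean square.  Membership in L2 is part of the definition because the Bochner
   integral of a non-integrable function is 0. *)
definition ms_tendsto :: "'a measure \<Rightarrow> (nat \<Rightarrow> 'a \<Rightarrow> real) \<Rightarrow> ('a \<Rightarrow> real) \<Rightarrow> bool" where
  "ms_tendsto M Z Y \<longleftrightarrow> (\<forall>n. Z n \<in> L2 M) \<and> Y \<in> L2 M \<and>
     (\<lambda>n. \<integral>\<omega>. (Z n \<omega> - Y \<omega>)\<^sup>2 \<partial>M) \<longlonglongrightarrow> 0"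

definition zero_mean_weakly_stationary :: "'a measure \<Rightarrow> (int \<Rightarrow> 'a \<Rightarrow> real) \<Rightarrow> bool" where
  "zero_mean_weakly_stationary M X \<longleftrightarrow>
     (\<forall>t. X t \<in> L2 M) \<and>
     (\<forall>t. (\<integral>\<omega>. X t \<omega> \<partial>M) = 0) \<and>
     (\<exists>\<gamma> :: int \<Rightarrow> real. \<forall>t k. (\<integral>\<omega>. X t \<omega> * X (t + k) \<omega> \<partial>M) = \<gamma> k)"

definition white_noise :: "'a measure \<Rightarrow> (int \<Rightarrow> 'a \<Rightarrow> real) \<Rightarrow> real \<Rightarrow> bool" where
  "white_noise M \<epsilon> v \<longleftrightarrow>
     (\<forall>t. \<epsilon> t \<in> L2 M) \<and>
     (\<forall>t. (\<integral>\<omega>. \<epsilon> t \<omega> \<partial>M) = 0) \<and>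
     (\<forall>t. (\<integral>\<omega>. (\<epsilon> t \<omega>)\<^sup>2 \<partial>M) = v) \<and>
     (\<forall>s t. s \<noteq> t \<longrightarrow> (\<integral>\<omega>. \<epsilon> s \<omega> * \<epsilon> t \<omega> \<partial>M) = 0)"

(* In both representations the coefficients are indexed from 1; the values at 0 are irrelevant. *)
definition AR_infinity ::
  "'a measure \<Rightarrow> (int \<Rightarrow> 'a \<Rightarrow> real) \<Rightarrow> (int \<Rightarrow> 'a \<Rightarrow> real) \<Rightarrow> (nat \<Rightarrow> real) \<Rightarrow> bool" where
  "AR_infinity M X \<epsilon> \<pi> \<longleftrightarrow>
     summable (\<lambda>i. \<bar>\<pi> (Suc i)\<bar>) \<and>
     (\<forall>t. ms_tendsto M (\<lambda>n \<omega>. (\<Sum>i=1..n. \<pi> i * X (t - int i) \<omega>) + \<epsilon> t \<omega>) (X t))"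

definition MA_infinity ::
  "'a measure \<Rightarrow> (int \<Rightarrow> 'a \<Rightarrow> real) \<Rightarrow> (int \<Rightarrow> 'a \<Rightarrow> real) \<Rightarrow> (nat \<Rightarrow> real) \<Rightarrow> bool" where
  "MA_infinity M X \<epsilon> \<psi> \<longleftrightarrow>
     summable (\<lambda>i. \<bar>\<psi> (Suc i)\<bar>) \<and>
     (\<forall>t. ms_tendsto M (\<lambda>n \<omega>. \<epsilon> t \<omega> + (\<Sum>i=1..n. \<psi> i * \<epsilon> (t - int i) \<omega>)) (X t))"

definition lin_span :: "(int \<Rightarrow> 'a \<Rightarrow> real) \<Rightarrow> int set \<Rightarrow> ('a \<Rightarrow> real) set" where
  "lin_span X I = {(\<lambda>\<omega>. \<Sum>t\<in>F. c t * X t \<omega>) | F c. finite F \<and> F \<subseteq> I}"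

(* The closed subspace H_I. *)
definition closed_span :: "'a measure \<Rightarrow> (int \<Rightarrow> 'a \<Rightarrow> real) \<Rightarrow> int set \<Rightarrow> ('a \<Rightarrow> real) set" where
  "closed_span M X I = {Y. \<exists>Z. (\<forall>n. Z n \<in> lin_span X I) \<and> ms_tendsto M Z Y}"

(* P is a version of P_I Y, the orthogonal projection of Y onto H_I; as an element of L2 it is
   unique, as a function it is unique only up to null sets, hence a relation. *)
definition is_projection ::
  "'a measure \<Rightarrow> (int \<Rightarrow> 'a \<Rightarrow> real) \<Rightarrow> int set \<Rightarrow> ('a \<Rightarrow> real) \<Rightarrow> ('a \<Rightarrow> real) \<Rightarrow> bool" where
  "is_projection M X I Y P \<longleftrightarrow> P \<in> closed_span M X I \<and>
     (\<forall>W \<in> closed_span M X I. (\<integral>\<omega>. (Y \<omega> - P \<omega>) * W \<omega> \<partial>M) = 0)"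

(* The numbers c 1, ..., c k are the coefficients in
   P_[t-k,t-1] X_t = c 1 X_(t-1) + ... + c k X_(t-k), with the same coefficients for every t. *)
definition prediction_coeffs ::
  "'a measure \<Rightarrow> (int \<Rightarrow> 'a \<Rightarrow> real) \<Rightarrow> nat \<Rightarrow> (nat \<Rightarrow> real) \<Rightarrow> bool" where
  "prediction_coeffs M X k c \<longleftrightarrow>
     (\<forall>t. is_projection M X {t - int k..t - 1} (X t) (\<lambda>\<omega>. \<Sum>j=1..k. c j * X (t - int j) \<omega>))"

(* The k-th partial autocorrelation coefficient (k >= 1).  It is meaningful when X_(t-1), ...,
   X_(t-k) are linearly independent in L2, which makes the prediction coefficients unique. *)
definition pacf :: "'a measure \<Rightarrow> (int \<Rightarrow> 'a \<Rightarrow> real) \<Rightarrow> nat \<Rightarrow> real" where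
  "pacf M X k = (THE a. \<exists>c. prediction_coeffs M X k c \<and> c k = a)"

end

theory Submission
  imports Defs "HOL-Library.Landau_Symbols"
begin

text \<open>
  Let \<open>\<phi> n j\<close> be the coefficient of \<open>X (t - j)\<close> in the projection of \<open>X t\<close> on its last \<open>n\<close>
  predecessors. The two inequalities come from two relations between these coefficients and the
  numbers \<open>\<pi> j\<close>, which are the coefficients of the prediction from the whole past.

  The first is an error bound, \<open>levinson_error\<close>:
  \<open>\<bar>\<phi> n j - \<pi> j\<bar> \<le> C * (\<Sum>l>n. \<bar>\<pi> l\<bar>)\<close>, uniformly in \<open>j \<le> n\<close>. Truncating the AR series after
  \<open>n\<close> terms gives a linear combination of \<open>X (t - 1), \<dots>, X (t - n)\<close> whose distance from the projection
  is at most the norm of the omitted terms. To pass from this distance to the coefficients one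
  needs a lower bound for the covariance form by the sum of the squares of the coefficients. It
  holds because the noise is an absolutely summable filter of the process: a
  combination of the \<open>\<epsilon> t\<close>, whose norm is known exactly, is the image of the same combination of the
  \<open>X t\<close> under a bounded operator (\<open>covariance_coercive\<close>). With \<open>j = n\<close> the bound shows that
  geometric decay of \<open>\<pi> n\<close> passes to \<open>\<phi> n n\<close> at the same rate.

  The second is the Levinson recursion
  \<open>\<phi> (n + 1) j = \<phi> n j - \<phi> (n + 1) (n + 1) * \<phi> n (n + 1 - j)\<close>. Since \<open>\<phi> n j\<close> tends to \<open>\<pi> j\<close> by the
  error bound, it expresses \<open>\<pi> j\<close> as \<open>\<phi> j j\<close> plus a series of the \<open>\<phi> m m\<close> with \<open>m > j\<close> and bounded
  multipliers, so geometric decay of \<open>\<phi> n n\<close> passes back to \<open>\<pi> n\<close>.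

  An upper limit of \<open>n\<close>-th roots is the infimum of the possible geometric rates, and both sequences
  are bounded, so the two transfers give the two inequalities
  (\<open>limsup_root_le_limsup_root\<close>). The covariance enters only through its symmetry, the Yule-Walker
  equations, the lower bound and the Cauchy-Schwarz inequality; the middle part of the development is therefore
  about a sequence \<open>\<gamma>\<close> with these properties.
\<close>

section \<open>Square-integrable functions\<close>

definition inner2 :: "'a measure \<Rightarrow> ('a \<Rightarrow> real) \<Rightarrow> ('a \<Rightarrow> real) \<Rightarrow> real" where
  "inner2 M Y Z = (\<integral>\<omega>. Y \<omega> * Z \<omega> \<partial>M)"

definition norm2 :: "'a measure \<Rightarrow> ('a \<Rightarrow> real) \<Rightarrow> real" where
  "norm2 M Y = sqrt (inner2 M Y Y)"

lemma L2_integrable_mult: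
  assumes "Y \<in> L2 M" "Z \<in> L2 M"
  shows "integrable M (\<lambda>\<omega>. Y \<omega> * Z \<omega>)"
proof (rule Bochner_Integration.integrable_bound)
  show "integrable M (\<lambda>\<omega>. (Y \<omega>)\<^sup>2 + (Z \<omega>)\<^sup>2)"
    using assms by (auto simp: L2_def)
  show "(\<lambda>\<omega>. Y \<omega> * Z \<omega>) \<in> borel_measurable M"
    using assms by (auto simp: L2_def)
  have "\<bar>y * z\<bar> \<le> y\<^sup>2 + z\<^sup>2" for y z :: real
    using sum_squares_bound[of "\<bar>y\<bar>" "\<bar>z\<bar>"] abs_ge_zero[of "y * z"]
    unfolding abs_mult power2_abs by linarith
  then show "AE \<omega> in M. norm (Y \<omega> * Z \<omega>) \<le> norm ((Y \<omega>)\<^sup>2 + (Z \<omega>)\<^sup>2)"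
    by auto
qed

lemma L2_scale: "Y \<in> L2 M \<Longrightarrow> (\<lambda>\<omega>. c * Y \<omega>) \<in> L2 M"
  by (auto simp: L2_def power_mult_distrib)

lemma L2_add:
  assumes "Y \<in> L2 M" "Z \<in> L2 M"
  shows "(\<lambda>\<omega>. Y \<omega> + Z \<omega>) \<in> L2 M"
  using assms L2_integrable_mult[OF assms] by (auto simp: L2_def power2_sum mult.assoc)

lemma L2_diff:
  assumes "Y \<in> L2 M" "Z \<in> L2 M"
  shows "(\<lambda>\<omega>. Y \<omega> - Z \<omega>) \<in> L2 M"
  using assms L2_integrable_mult[OF assms] by (auto simp: L2_def power2_diff mult.assoc)

lemma L2_sum:
  assumes "\<And>i. i \<in> F \<Longrightarrow> Y i \<in> L2 M"
  shows "(\<lambda>\<omega>. \<Sum>i\<in>F. c i * Y i \<omega>) \<in> L2 M"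
proof (cases "finite F")
  case True
  then show ?thesis
    using assms
  proof (induction F)
    case empty
    then show ?case by (auto simp: L2_def)
  next
    case (insert i F)
    then show ?case using L2_add[OF L2_scale[of "Y i" M "c i"], of "\<lambda>\<omega>. \<Sum>i\<in>F. c i * Y i \<omega>"]
      by simp
  qed
next
  case False
  then show ?thesis by (auto simp: L2_def)
qed

lemma inner2_commute: "inner2 M Y Z = inner2 M Z Y"
  by (simp add: inner2_def mult.commute)

lemma inner2_scale_left: "inner2 M (\<lambda>\<omega>. c * Y \<omega>) Z = c * inner2 M Y Z"
  by (simp add: inner2_def mult.assoc)

lemma inner2_add_left:
  assumes "Y \<in> L2 M" "Y' \<in> L2 M" "Z \<in> L2 M"
  shows "inner2 M (\<lambda>\<omega>. Y \<omega> + Y' \<omega>) Z = inner2 M Y Z + inner2 M Y' Z"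
  using assms by (simp add: inner2_def distrib_right L2_integrable_mult)

lemma inner2_diff_left:
  assumes "Y \<in> L2 M" "Y' \<in> L2 M" "Z \<in> L2 M"
  shows "inner2 M (\<lambda>\<omega>. Y \<omega> - Y' \<omega>) Z = inner2 M Y Z - inner2 M Y' Z"
  using assms by (simp add: inner2_def left_diff_distrib L2_integrable_mult)

lemma inner2_sum_left:
  assumes "\<And>i. i \<in> F \<Longrightarrow> Y i \<in> L2 M" "Z \<in> L2 M"
  shows "inner2 M (\<lambda>\<omega>. \<Sum>i\<in>F. c i * Y i \<omega>) Z = (\<Sum>i\<in>F. c i * inner2 M (Y i) Z)"
proof -
  have "inner2 M (\<lambda>\<omega>. \<Sum>i\<in>F. c i * Y i \<omega>) Z = (\<integral>\<omega>. (\<Sum>i\<in>F. c i * (Y i \<omega> * Z \<omega>)) \<partial>M)"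
    by (simp add: inner2_def sum_distrib_right mult.assoc)
  also have "\<dots> = (\<Sum>i\<in>F. c i * inner2 M (Y i) Z)"
    using assms by (subst Bochner_Integration.integral_sum) (auto simp: inner2_def intro!: L2_integrable_mult)
  finally show ?thesis .
qed

lemma inner2_self_nonneg: "0 \<le> inner2 M Y Y"
  by (simp add: inner2_def)

lemma norm2_nonneg: "0 \<le> norm2 M Y"
  by (simp add: norm2_def inner2_self_nonneg)

lemma norm2_square: "(norm2 M Y)\<^sup>2 = inner2 M Y Y"
  by (simp add: norm2_def inner2_self_nonneg)

text \<open>Completing the square: \<open>Y - s * Z\<close> has a nonnegative second moment for every real \<open>s\<close>.\<close>

lemma Cauchy_Schwarz_inner2_square:
  assumes Y: "Y \<in> L2 M" and Z: "Z \<in> L2 M"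
  shows "(inner2 M Y Z)\<^sup>2 \<le> inner2 M Y Y * inner2 M Z Z"
proof -
  define a b d where "a = inner2 M Y Y" and "b = inner2 M Y Z" and "d = inner2 M Z Z"
  have quad: "0 \<le> a - 2 * s * b + s\<^sup>2 * d" for s
  proof -
    define V where "V = (\<lambda>\<omega>. Y \<omega> - s * Z \<omega>)"
    have V: "V \<in> L2 M" unfolding V_def by (intro L2_diff L2_scale Y Z)
    have "inner2 M V V = inner2 M Y V - s * inner2 M Z V"
      by (subst V_def) (simp add: inner2_diff_left inner2_scale_left L2_scale Y Z V)
    moreover have "inner2 M V W = inner2 M Y W - s * inner2 M Z W" if "W \<in> L2 M" for W
      by (simp add: V_def inner2_diff_left inner2_scale_left L2_scale Y Z that)
    ultimately have "inner2 M V V = a - 2 * s * b + s\<^sup>2 * d"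
      using Y Z inner2_commute[of M Y V] inner2_commute[of M Z V] inner2_commute[of M Z Y]
      by (simp add: a_def b_def d_def algebra_simps power2_eq_square)
    then show ?thesis using inner2_self_nonneg[of M V] by simp
  qed
  have d: "0 \<le> d" by (simp add: d_def inner2_self_nonneg)
  have "b\<^sup>2 \<le> a * d"
  proof (cases "d = 0")
    case True
    have "b = 0"
    proof (rule ccontr)
      \<comment> \<open>The quadratic is affine here, and the point chosen gives it the value -1.\<close>
      assume "b \<noteq> 0"
      then show False using quad[of "(a + 1) / (2 * b)"] True by simp
    qed
    then show ?thesis using True by simp
  next
    case False
    then show ?thesis using quad[of "b / d"] d by (simp add: field_simps power2_eq_square)
  qed
  then show ?thesis by (simp add: a_def b_def d_def)
qed

lemma Cauchy_Schwarz_inner2: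
  assumes "Y \<in> L2 M" "Z \<in> L2 M"
  shows "\<bar>inner2 M Y Z\<bar> \<le> norm2 M Y * norm2 M Z"
  using real_sqrt_le_mono[OF Cauchy_Schwarz_inner2_square[OF assms]]
  by (simp add: norm2_def real_sqrt_mult)

text \<open>
  All uses of the two series representations go through their inner products with a fixed element,
  which turn mean-square convergence into convergence of real series.
\<close>

lemma ms_tendsto_inner2:
  assumes Z: "ms_tendsto M Z Y" and W: "W \<in> L2 M"
  shows "(\<lambda>n. inner2 M (Z n) W) \<longlonglongrightarrow> inner2 M Y W"
proof -
  have ZL: "Z n \<in> L2 M" and YL: "Y \<in> L2 M" for n
    using Z by (auto simp: ms_tendsto_def)
  define D where "D n = (\<lambda>\<omega>. Z n \<omega> - Y \<omega>)" for n
  have DL: "D n \<in> L2 M" for n unfolding D_def by (intro L2_diff ZL YL)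
  have "(\<lambda>n. inner2 M (D n) (D n)) \<longlonglongrightarrow> 0"
    using Z by (simp add: ms_tendsto_def D_def inner2_def power2_eq_square)
  then have "(\<lambda>n. norm2 M (D n)) \<longlonglongrightarrow> 0"
    unfolding norm2_def using tendsto_real_sqrt by fastforce
  then have lim: "(\<lambda>n. norm2 M (D n) * norm2 M W) \<longlonglongrightarrow> 0"
    by (rule tendsto_mult_left_zero)
  have "(\<lambda>n. inner2 M (D n) W) \<longlonglongrightarrow> 0"
    by (rule Lim_null_comparison[OF _ lim]) (simp add: Cauchy_Schwarz_inner2 DL W)
  moreover have "inner2 M (D n) W = inner2 M (Z n) W - inner2 M Y W" for n
    by (simp add: D_def inner2_diff_left ZL YL W)
  ultimately show ?thesis by (simp add: LIM_zero_iff)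
qed

section \<open>Coercive Toeplitz forms and the Levinson recursion\<close>

text \<open>
  \<open>levinson \<gamma> n j\<close> solves the normal equations of order \<open>n\<close> for \<open>1 \<le> j \<le> n\<close>; its values at other
  \<open>j\<close> have no meaning. The numerator of \<open>\<kappa>\<close> is the covariance of the two prediction errors of order
  \<open>n\<close>, forward and backward, at distance \<open>n + 1\<close>, and the denominator is the variance of either.
\<close>

primrec levinson :: "(int \<Rightarrow> real) \<Rightarrow> nat \<Rightarrow> nat \<Rightarrow> real" where
  "levinson \<gamma> 0 = (\<lambda>j. 0)"
| "levinson \<gamma> (Suc n) =
    (let \<kappa> = (\<gamma> (int (Suc n)) - (\<Sum>j=1..n. levinson \<gamma> n j * \<gamma> (int (Suc n) - int j)))
             / (\<gamma> 0 - (\<Sum>j=1..n. levinson \<gamma> n j * \<gamma> (int j)))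
     in (\<lambda>j. if j = Suc n then \<kappa> else levinson \<gamma> n j - \<kappa> * levinson \<gamma> n (Suc n - j)))"

lemma levinson_step:
  assumes "j \<le> n"
  shows "levinson \<gamma> (Suc n) j
    = levinson \<gamma> n j - levinson \<gamma> (Suc n) (Suc n) * levinson \<gamma> n (Suc n - j)"
  using assms by (simp add: Let_def)

text \<open>
  For an autocovariance, \<open>coercive\<close> says that the norm of a linear combination of the process
  dominates the Euclidean norm of its coefficients up to a constant. Equivalently, \<open>m\<close> is a lower bound of the
  spectral density up to normalisation.
\<close>

locale coercive_toeplitz =
  fixes \<gamma> :: "int \<Rightarrow> real" and m :: real
  assumes even: "\<gamma> (- k) = \<gamma> k"
    and m_pos: "0 < m"
    and coercive: "finite F \<Longrightarrow>
      m * (\<Sum>i\<in>F. (c i)\<^sup>2) \<le> (\<Sum>i\<in>F. c i * (\<Sum>j\<in>F. c j * \<gamma> (int i - int j)))"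
begin

definition normal_equations :: "nat \<Rightarrow> (nat \<Rightarrow> real) \<Rightarrow> bool" where
  "normal_equations n c \<longleftrightarrow> (\<forall>i\<in>{1..n}. (\<Sum>j=1..n. c j * \<gamma> (int i - int j)) = \<gamma> (int i))"

lemma toeplitz_kernel_trivial:
  assumes "finite F" and "\<And>i. i \<in> F \<Longrightarrow> (\<Sum>j\<in>F. d j * \<gamma> (int i - int j)) = 0" and "i \<in> F"
  shows "d i = 0"
proof -
  have "m * (\<Sum>i\<in>F. (d i)\<^sup>2) \<le> 0"
    using coercive[OF assms(1), of d] assms(2) by simp
  then have "(\<Sum>i\<in>F. (d i)\<^sup>2) \<le> 0"
    using m_pos by (simp add: mult_le_0_iff)
  moreover have "(d i)\<^sup>2 \<le> (\<Sum>i\<in>F. (d i)\<^sup>2)"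
    using assms by (intro member_le_sum) auto
  ultimately show ?thesis by (metis order_trans power2_less_eq_zero_iff)
qed

lemma normal_equations_unique:
  assumes "normal_equations n c" "normal_equations n d" "j \<in> {1..n}"
  shows "c j = d j"
proof -
  have "c j - d j = 0"
    by (rule toeplitz_kernel_trivial[of "{1..n}" "\<lambda>j. c j - d j"])
      (use assms in \<open>auto simp: normal_equations_def left_diff_distrib sum_subtractf\<close>)
  then show ?thesis by simp
qed

text \<open>
  The quantity is the mean-square prediction error, that is, the quadratic form at the vector
  \<open>(1, - c 1, \<dots>, - c n)\<close>: by the normal equations only the row with index 0 contributes.
\<close>

lemma prediction_error_pos:
  assumes "normal_equations n c"
  shows "0 < \<gamma> 0 - (\<Sum>j=1..n. c j * \<gamma> (int j))"
proof -
  define d where "d j = (if j = 0 then 1 else - c j)" for j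
  have split: "(\<Sum>j\<in>{0..n}. d j * f j) = f 0 - (\<Sum>j=1..n. c j * f j)" for f :: "nat \<Rightarrow> real"
    by (simp add: sum.atLeast_Suc_atMost[of 0 n] d_def sum_negf)
  have zero: "(\<Sum>j\<in>{0..n}. d j * \<gamma> (int i - int j)) = 0" if "i \<in> {1..n}" for i
    using assms that by (subst split) (auto simp: normal_equations_def)
  have "m * 1 \<le> m * (\<Sum>i\<in>{0..n}. (d i)\<^sup>2)"
    using m_pos member_le_sum[of 0 "{0..n}" "\<lambda>i. (d i)\<^sup>2"] by (auto simp: d_def)
  also have "\<dots> \<le> (\<Sum>i\<in>{0..n}. d i * (\<Sum>j\<in>{0..n}. d j * \<gamma> (int i - int j)))"
    by (rule coercive) simp
  also have "\<dots> = (\<Sum>j\<in>{0..n}. d j * \<gamma> (0 - int j))"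
    by (subst split, subst (2) sum.neutral) (use zero in auto)
  also have "\<dots> = \<gamma> 0 - (\<Sum>j=1..n. c j * \<gamma> (int j))"
    by (subst split) (simp add: even)
  finally show ?thesis using m_pos by simp
qed

text \<open>
  Reversing the order of the solution of order \<open>n\<close> solves the same Toeplitz system with the reversed
  right-hand side, because \<open>\<gamma>\<close> is even. Subtracting a multiple of it therefore keeps rows
  \<open>1, \<dots>, n\<close> correct after the unknown \<open>\<kappa>\<close> has been added, and the value of \<open>\<kappa>\<close> is the one that
  row \<open>n + 1\<close> demands. The recursion thus shows solvability as well.
\<close>

theorem levinson_normal_equations: "normal_equations n (levinson \<gamma> n)"
proof (induction n)
  case 0
  then show ?case by (simp add: normal_equations_def)
next
  case (Suc n)
  define \<phi> where "\<phi> = levinson \<gamma> n"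
  define \<kappa> where "\<kappa> = levinson \<gamma> (Suc n) (Suc n)"
  have ne: "(\<Sum>j=1..n. \<phi> j * \<gamma> (int i - int j)) = \<gamma> (int i)" if "i \<in> {1..n}" for i
    using Suc that by (auto simp: normal_equations_def \<phi>_def)
  have v: "0 < \<gamma> 0 - (\<Sum>j=1..n. \<phi> j * \<gamma> (int j))"
    using prediction_error_pos[OF Suc] by (simp add: \<phi>_def)
  have \<kappa>: "\<kappa> * (\<gamma> 0 - (\<Sum>j=1..n. \<phi> j * \<gamma> (int j)))
      = \<gamma> (int (Suc n)) - (\<Sum>j=1..n. \<phi> j * \<gamma> (int (Suc n) - int j))"
    using v by (simp add: \<kappa>_def \<phi>_def Let_def)
  have rev: "(\<Sum>j=1..n. \<phi> (Suc n - j) * \<gamma> (int i - int j))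
      = (\<Sum>j=1..n. \<phi> j * \<gamma> (int (Suc n - i) - int j))" if "i \<in> {1..Suc n}" for i
  proof -
    have "(\<Sum>j=1..n. \<phi> (Suc n - j) * \<gamma> (int i - int j))
        = (\<Sum>j=1..n. \<phi> j * \<gamma> (int i - int (Suc n - j)))"
      by (rule sum.reindex_bij_witness[where i = "\<lambda>j. Suc n - j" and j = "\<lambda>j. Suc n - j"]) auto
    also have "\<dots> = (\<Sum>j=1..n. \<phi> j * \<gamma> (int (Suc n - i) - int j))"
    proof (rule sum.cong[OF refl])
      fix j assume "j \<in> {1..n}"
      then have "int i - int (Suc n - j) = - (int (Suc n - i) - int j)"
        using that by auto
      then show "\<phi> j * \<gamma> (int i - int (Suc n - j)) = \<phi> j * \<gamma> (int (Suc n - i) - int j)"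
        by (metis even)
    qed
    finally show ?thesis .
  qed
  have total: "(\<Sum>j=1..Suc n. levinson \<gamma> (Suc n) j * \<gamma> (int i - int j))
      = (\<Sum>j=1..n. \<phi> j * \<gamma> (int i - int j))
        - \<kappa> * (\<Sum>j=1..n. \<phi> j * \<gamma> (int (Suc n - i) - int j)) + \<kappa> * \<gamma> (int i - int (Suc n))"
    if "i \<in> {1..Suc n}" for i
  proof -
    have "(\<Sum>j=1..n. levinson \<gamma> (Suc n) j * \<gamma> (int i - int j))
        = (\<Sum>j=1..n. (\<phi> j - \<kappa> * \<phi> (Suc n - j)) * \<gamma> (int i - int j))"
      by (rule sum.cong) (auto simp: levinson_step \<phi>_def \<kappa>_def simp del: levinson.simps)
    also have "\<dots> = (\<Sum>j=1..n. \<phi> j * \<gamma> (int i - int j))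
        - \<kappa> * (\<Sum>j=1..n. \<phi> (Suc n - j) * \<gamma> (int i - int j))"
      by (simp add: left_diff_distrib sum_subtractf sum_distrib_left mult.assoc)
    finally show ?thesis
      using rev[OF that] by (simp add: \<kappa>_def del: levinson.simps)
  qed
  show ?case
    unfolding normal_equations_def
  proof
    fix i assume i: "i \<in> {1..Suc n}"
    show "(\<Sum>j=1..Suc n. levinson \<gamma> (Suc n) j * \<gamma> (int i - int j)) = \<gamma> (int i)"
    proof (cases "i = Suc n")
      case True
      have "(\<Sum>j=1..n. \<phi> j * \<gamma> (int (Suc n - i) - int j)) = (\<Sum>j=1..n. \<phi> j * \<gamma> (int j))"
        using True by (simp add: even)
      then show ?thesis
        using \<kappa> True by (subst total[OF i]) (simp add: algebra_simps)
    next
      case False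
      then have "i \<in> {1..n}" "Suc n - i \<in> {1..n}" using i by auto
      moreover have "\<gamma> (int i - int (Suc n)) = \<gamma> (int (Suc n - i))"
        using even[of "int (Suc n - i)"] i by simp
      ultimately show ?thesis
        using ne[of i] ne[of "Suc n - i"] by (subst total[OF i]) simp
    qed
  qed
qed

end

section \<open>Convergence of the prediction coefficients\<close>

text \<open>
  In \<open>cauchy_schwarz\<close> the left-hand side is the squared inner product of the combination
  \<open>\<Sum>i\<in>F. c i * X (- i)\<close> with \<open>X (- l)\<close>, where \<open>l\<close> may lie outside \<open>F\<close>.
\<close>

locale AR_covariance = coercive_toeplitz +
  fixes \<pi> :: "nat \<Rightarrow> real"
  assumes abs_summable: "summable (\<lambda>i. \<bar>\<pi> (Suc i)\<bar>)"
    and yule_walker: "1 \<le> i \<Longrightarrow> (\<lambda>l. \<pi> (Suc l) * \<gamma> (int i - int (Suc l))) sums \<gamma> (int i)"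
    and cauchy_schwarz: "finite F \<Longrightarrow> (\<Sum>i\<in>F. c i * \<gamma> (int i - int l))\<^sup>2
      \<le> \<gamma> 0 * (\<Sum>i\<in>F. c i * (\<Sum>j\<in>F. c j * \<gamma> (int i - int j)))"
begin

abbreviation \<phi> :: "nat \<Rightarrow> nat \<Rightarrow> real" where
  "\<phi> \<equiv> levinson \<gamma>"

definition tail :: "nat \<Rightarrow> real" where
  "tail n = (\<Sum>l. \<bar>\<pi> (Suc (l + n))\<bar>)"

lemma summable_tail: "summable (\<lambda>l. \<bar>\<pi> (Suc (l + n))\<bar>)"
  using summable_iff_shift[of "\<lambda>l. \<bar>\<pi> (Suc l)\<bar>" n] abs_summable by simp

lemma tail_nonneg: "0 \<le> tail n"
  unfolding tail_def by (rule suminf_nonneg[OF summable_tail]) simp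

lemma tail_tendsto_0: "tail \<longlonglongrightarrow> 0"
  unfolding tail_def using suminf_exist_split2[OF abs_summable] by simp

lemma variance_nonneg: "0 \<le> \<gamma> 0"
  using coercive[of "{0}" "\<lambda>_. 1"] m_pos by simp

definition C :: real where "C = sqrt (\<gamma> 0 / m)"

lemma C_nonneg: "0 \<le> C"
  using m_pos variance_nonneg by (simp add: C_def)

text \<open>
  Let \<open>e\<close> be the difference of the coefficients and \<open>Q\<close> the value of the quadratic form at \<open>e\<close>. By the
  Yule-Walker equations, \<open>e\<close> solves the Toeplitz system whose right-hand side is made of the
  terms with \<open>l > n\<close> that the truncation omits. Testing that system with \<open>e\<close> itself and using
  Cauchy-Schwarz gives \<open>Q \<le> tail n * sqrt (\<gamma> 0) * sqrt Q\<close>, hence a bound for \<open>sqrt Q\<close>, which by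
  coercivity dominates every \<open>\<bar>e j\<bar>\<close> up to the factor \<open>sqrt m\<close>.
\<close>

theorem levinson_error:
  assumes j: "j \<in> {1..n}"
  shows "\<bar>\<phi> n j - \<pi> j\<bar> \<le> C * tail n"
proof -
  define e where "e j = \<phi> n j - \<pi> j" for j
  define Q where "Q = (\<Sum>i\<in>{1..n}. e i * (\<Sum>j\<in>{1..n}. e j * \<gamma> (int i - int j)))"
  define B where "B l = (\<Sum>i\<in>{1..n}. e i * \<gamma> (int i - int l))" for l
  have coer: "m * (\<Sum>i\<in>{1..n}. (e i)\<^sup>2) \<le> Q"
    unfolding Q_def by (rule coercive) simp
  have "0 \<le> m * (\<Sum>i\<in>{1..n}. (e i)\<^sup>2)" using m_pos by (simp add: sum_nonneg)
  then have Q0: "0 \<le> Q" using coer by linarith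
  have row: "(\<lambda>l. \<pi> (Suc (l + n)) * \<gamma> (int i - int (Suc (l + n))))
      sums (\<Sum>j\<in>{1..n}. e j * \<gamma> (int i - int j))" if i: "i \<in> {1..n}" for i
  proof -
    have "(\<lambda>l. \<pi> (Suc (l + n)) * \<gamma> (int i - int (Suc (l + n))))
        sums (\<gamma> (int i) - (\<Sum>l<n. \<pi> (Suc l) * \<gamma> (int i - int (Suc l))))"
      by (rule sums_split_initial_segment[of "\<lambda>l. \<pi> (Suc l) * \<gamma> (int i - int (Suc l))"])
        (use yule_walker i in auto)
    moreover have "(\<Sum>l<n. \<pi> (Suc l) * \<gamma> (int i - int (Suc l))) = (\<Sum>j=1..n. \<pi> j * \<gamma> (int i - int j))"
      by (rule sum.reindex_bij_witness[where i = "\<lambda>j. j - 1" and j = Suc]) auto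
    moreover have "\<gamma> (int i) = (\<Sum>j=1..n. \<phi> n j * \<gamma> (int i - int j))"
      using levinson_normal_equations[of n] i by (auto simp: normal_equations_def)
    ultimately show ?thesis
      by (simp add: e_def left_diff_distrib sum_subtractf)
  qed
  have "(\<lambda>l. \<Sum>i\<in>{1..n}. e i * (\<pi> (Suc (l + n)) * \<gamma> (int i - int (Suc (l + n))))) sums Q"
    unfolding Q_def by (intro sums_sum sums_mult row)
  then have sumsQ: "(\<lambda>l. \<pi> (Suc (l + n)) * B (Suc (l + n))) sums Q"
    by (simp add: B_def sum_distrib_left mult.left_commute)
  have B: "\<bar>B l\<bar> \<le> sqrt (\<gamma> 0) * sqrt Q" for l
    using real_sqrt_le_mono[OF cauchy_schwarz[of "{1..n}" e l]]
    by (simp add: B_def Q_def real_sqrt_mult)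
  have "Q \<le> tail n * (sqrt (\<gamma> 0) * sqrt Q)"
  proof (rule sums_le[OF _ sumsQ])
    show "(\<lambda>l. \<bar>\<pi> (Suc (l + n))\<bar> * (sqrt (\<gamma> 0) * sqrt Q)) sums (tail n * (sqrt (\<gamma> 0) * sqrt Q))"
      unfolding tail_def by (intro sums_mult2 summable_sums summable_tail)
    fix l
    have "\<pi> (Suc (l + n)) * B (Suc (l + n)) \<le> \<bar>\<pi> (Suc (l + n))\<bar> * \<bar>B (Suc (l + n))\<bar>"
      by (metis abs_ge_self abs_mult)
    also have "\<dots> \<le> \<bar>\<pi> (Suc (l + n))\<bar> * (sqrt (\<gamma> 0) * sqrt Q)"
      by (intro mult_left_mono B) simp
    finally show "\<pi> (Suc (l + n)) * B (Suc (l + n)) \<le> \<bar>\<pi> (Suc (l + n))\<bar> * (sqrt (\<gamma> 0) * sqrt Q)" .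
  qed
  then have "sqrt Q * sqrt Q \<le> (tail n * sqrt (\<gamma> 0)) * sqrt Q"
    using Q0 by (simp add: mult.assoc)
  then have sqrtQ: "sqrt Q \<le> tail n * sqrt (\<gamma> 0)"
    using Q0 tail_nonneg[of n] variance_nonneg mult_right_le_imp_le[of "sqrt Q" "sqrt Q"] by (cases "Q = 0") auto
  have "m * (e j)\<^sup>2 \<le> m * (\<Sum>i\<in>{1..n}. (e i)\<^sup>2)"
    using j m_pos by (intro mult_left_mono member_le_sum) auto
  then have "m * (e j)\<^sup>2 \<le> Q"
    using coer by linarith
  then have "(e j)\<^sup>2 \<le> Q / m"
    using m_pos by (simp add: field_simps)
  then have "\<bar>e j\<bar> \<le> sqrt Q / sqrt m"
    by (metis real_sqrt_abs real_sqrt_divide real_sqrt_le_mono)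
  also have "\<dots> \<le> (tail n * sqrt (\<gamma> 0)) / sqrt m"
    using sqrtQ m_pos by (simp add: divide_right_mono)
  also have "\<dots> = C * tail n"
    by (simp add: C_def real_sqrt_divide)
  finally show ?thesis by (simp add: e_def)
qed

lemma levinson_tendsto:
  assumes "1 \<le> j"
  shows "(\<lambda>n. \<phi> n j) \<longlonglongrightarrow> \<pi> j"
proof -
  have "(\<lambda>n. \<phi> n j - \<pi> j) \<longlonglongrightarrow> 0"
  proof (rule Lim_null_comparison)
    show "(\<lambda>n. C * tail n) \<longlonglongrightarrow> 0"
      using tendsto_mult_right_zero[OF tail_tendsto_0] .
    show "\<forall>\<^sub>F n in sequentially. norm (\<phi> n j - \<pi> j) \<le> C * tail n"
      using eventually_ge_at_top[of j]
      by eventually_elim (use levinson_error assms in auto)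
  qed
  then show ?thesis by (simp add: LIM_zero_iff)
qed

lemma coefficient_bounded: "1 \<le> j \<Longrightarrow> \<bar>\<pi> j\<bar> \<le> tail 0"
  using sum_le_suminf[OF abs_summable, of "{j - 1}"] by (simp add: tail_def)

lemma tail_le: "tail n \<le> tail 0"
  unfolding tail_def
  using suminf_split_initial_segment[OF abs_summable, of n] by (simp add: sum_nonneg)

lemma levinson_bounded:
  assumes "j \<in> {1..n}"
  shows "\<bar>\<phi> n j\<bar> \<le> (1 + C) * tail 0"
proof -
  have "\<bar>\<phi> n j\<bar> \<le> \<bar>\<pi> j\<bar> + \<bar>\<phi> n j - \<pi> j\<bar>" by linarith
  also have "\<dots> \<le> tail 0 + C * tail 0"
    using levinson_error[OF assms] coefficient_bounded[of j] assms
      mult_left_mono[OF tail_le[of n] C_nonneg] by simp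
  finally show ?thesis by (simp add: algebra_simps)
qed

section \<open>Geometric rates\<close>

text \<open>The tail of a geometrically bounded series decays at the rate of its first term.\<close>

lemma reflection_in_bigo:
  assumes r: "0 < r" "r < 1" and \<pi>: "\<pi> \<in> O(\<lambda>n. r ^ n)"
  shows "(\<lambda>n. \<phi> n n) \<in> O(\<lambda>n. r ^ n)"
proof -
  obtain K where K: "\<forall>\<^sub>F n in sequentially. norm (\<pi> n) \<le> K * norm (r ^ n)"
    using \<pi> by (auto elim: landau_o.bigE)
  then obtain N where N: "\<And>n. n \<ge> N \<Longrightarrow> \<bar>\<pi> n\<bar> \<le> K * r ^ n"
    using r by (auto simp: eventually_sequentially)
  have tail_rate: "tail n \<le> K / (1 - r) * r ^ n" if "n \<ge> N" for n
  proof -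
    have "tail n \<le> (\<Sum>l. K * r ^ n * r ^ l)"
      unfolding tail_def
    proof (rule suminf_le[OF _ summable_tail])
      show "summable (\<lambda>l. K * r ^ n * r ^ l)"
        using r by (intro summable_mult summable_geometric) auto
      fix l
      have K0: "0 \<le> K"
        using N[of N] r by (metis abs_ge_zero order_trans order_refl zero_le_mult_iff zero_less_power not_le)
      have "\<bar>\<pi> (Suc (l + n))\<bar> \<le> K * r ^ (Suc (l + n))"
        using N[of "Suc (l + n)"] that by simp
      also have "\<dots> \<le> K * r ^ (l + n)"
        using r K0 by (intro mult_left_mono power_decreasing) auto
      finally show "\<bar>\<pi> (Suc (l + n))\<bar> \<le> K * r ^ n * r ^ l"
        by (simp add: power_add mult_ac)
    qed
    also have "\<dots> = K / (1 - r) * r ^ n"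
      using r by (simp add: suminf_mult suminf_geometric summable_geometric)
    finally show ?thesis .
  qed
  show ?thesis
  proof (rule bigoI)
    show "\<forall>\<^sub>F n in sequentially. norm (\<phi> n n) \<le> (K + C * (K / (1 - r))) * norm (r ^ n)"
      using eventually_ge_at_top[of "max 1 N"]
    proof eventually_elim
      case (elim n)
      have "\<bar>\<phi> n n\<bar> \<le> \<bar>\<pi> n\<bar> + C * tail n"
        using levinson_error[of n n] elim by simp
      also have "\<dots> \<le> K * r ^ n + C * (K / (1 - r) * r ^ n)"
        using N[of n] tail_rate[of n] elim C_nonneg by (intro add_mono mult_left_mono) auto
      finally show ?case using r by (simp add: algebra_simps)
    qed
  qed
qed

text \<open>
  Start at \<open>\<phi> j j\<close> and let the order grow: the \<open>d\<close>-th step of the Levinson recursion changes the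
  coefficient at \<open>j\<close> by at most a constant times \<open>r ^ (j + d)\<close>. The changes add up to a
  multiple of \<open>r ^ j\<close>, and the limit of the coefficient is \<open>\<pi> j\<close>.
\<close>

lemma coefficients_in_bigo:
  assumes r: "0 < r" "r < 1" and \<phi>: "(\<lambda>n. \<phi> n n) \<in> O(\<lambda>n. r ^ n)"
  shows "\<pi> \<in> O(\<lambda>n. r ^ n)"
proof -
  obtain K where "\<forall>\<^sub>F n in sequentially. norm (\<phi> n n) \<le> K * norm (r ^ n)"
    using \<phi> by (auto elim: landau_o.bigE)
  then obtain N where N: "\<And>n. n \<ge> N \<Longrightarrow> \<bar>\<phi> n n\<bar> \<le> K * r ^ n"
    using r by (auto simp: eventually_sequentially)
  define K0 where "K0 = (1 + C) * tail 0"
  have K0: "0 \<le> K0" using C_nonneg tail_nonneg by (simp add: K0_def)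
  have K: "0 \<le> K"
    using N[of N] r by (metis abs_ge_zero order_trans order_refl zero_le_mult_iff zero_less_power not_le)
  have step: "\<bar>\<phi> (j + d) j\<bar> \<le> K * r ^ j * (1 + K0 * (\<Sum>i<d. r ^ i))" if j: "1 \<le> j" "N \<le> j" for j d
  proof (induction d)
    case 0
    then show ?case using N[of j] that by simp
  next
    case (Suc d)
    have "\<bar>\<phi> (j + Suc d) j\<bar>
        \<le> \<bar>\<phi> (j + d) j\<bar> + \<bar>\<phi> (Suc (j + d)) (Suc (j + d))\<bar> * \<bar>\<phi> (j + d) (Suc (j + d) - j)\<bar>"
      using levinson_step[of j "j + d" \<gamma>] 
        abs_triangle_ineq4[of "\<phi> (j + d) j"
          "\<phi> (Suc (j + d)) (Suc (j + d)) * \<phi> (j + d) (Suc (j + d) - j)"]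
      by (simp add: abs_mult del: levinson.simps)
    also have "\<dots> \<le> K * r ^ j * (1 + K0 * (\<Sum>i<d. r ^ i)) + (K * r ^ (j + d)) * K0"
    proof (intro add_mono mult_mono Suc)
      have "K * r ^ Suc (j + d) \<le> K * r ^ (j + d)"
        using r K by (intro mult_left_mono power_decreasing) auto
      then show "\<bar>\<phi> (Suc (j + d)) (Suc (j + d))\<bar> \<le> K * r ^ (j + d)"
        using N[of "Suc (j + d)"] j by linarith
      show "\<bar>\<phi> (j + d) (Suc (j + d) - j)\<bar> \<le> K0"
        unfolding K0_def by (rule levinson_bounded) (use j in auto)
    qed (use K r in auto)
    also have "\<dots> = K * r ^ j * (1 + K0 * (\<Sum>i<Suc d. r ^ i))"
      by (simp add: power_add algebra_simps)
    finally show ?case .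
  qed
  have geometric: "(\<Sum>i<d. r ^ i) \<le> 1 / (1 - r)" for d
    using r sum_le_suminf[OF summable_geometric[of r], of "{..<d}"]
    by (simp add: suminf_geometric)
  show ?thesis
  proof (rule bigoI)
    show "\<forall>\<^sub>F j in sequentially. norm (\<pi> j) \<le> (K * (1 + K0 * (1 / (1 - r)))) * norm (r ^ j)"
      using eventually_ge_at_top[of "max 1 N"]
    proof eventually_elim
      case (elim j)
      have "(\<lambda>d. \<bar>\<phi> (j + d) j\<bar>) \<longlonglongrightarrow> \<bar>\<pi> j\<bar>"
        using LIMSEQ_ignore_initial_segment[OF levinson_tendsto[of j], of j] elim
        by (intro tendsto_rabs) (simp add: add.commute)
      moreover have "\<bar>\<phi> (j + d) j\<bar> \<le> K * r ^ j * (1 + K0 * (1 / (1 - r)))" for d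
      proof -
        have "\<bar>\<phi> (j + d) j\<bar> \<le> K * r ^ j * (1 + K0 * (\<Sum>i<d. r ^ i))"
          using step elim by simp
        also have "\<dots> \<le> K * r ^ j * (1 + K0 * (1 / (1 - r)))"
          using K K0 r geometric[of d] by (intro mult_left_mono add_left_mono) auto
        finally show ?thesis .
      qed
      ultimately have "\<bar>\<pi> j\<bar> \<le> K * r ^ j * (1 + K0 * (1 / (1 - r)))"
        by (intro LIMSEQ_le_const2) auto
      then show ?case using r by (simp add: mult_ac)
    qed
  qed
qed

end

text \<open>
  A rate \<open>r\<close> strictly above the upper limit for \<open>b\<close> gives \<open>b \<in> O(r ^ n)\<close>, and \<open>a \<in> O(r ^ n)\<close> bounds
  the upper limit for \<open>a\<close> by \<open>r\<close>, since the \<open>n\<close>-th roots of a positive constant tend to 1. Boundedness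
  of \<open>a\<close> covers the rates \<open>r \<ge> 1\<close>.
\<close>

lemma limsup_root_le_limsup_root:
  fixes a b :: "nat \<Rightarrow> real"
  assumes bounded: "a \<in> O(\<lambda>_. 1)"
    and geometric: "\<And>r. 0 < r \<Longrightarrow> r < 1 \<Longrightarrow> b \<in> O(\<lambda>n. r ^ n) \<Longrightarrow> a \<in> O(\<lambda>n. r ^ n)"
  shows "limsup (\<lambda>n. ereal (root n \<bar>a n\<bar>)) \<le> limsup (\<lambda>n. ereal (root n \<bar>b n\<bar>))"
proof (rule ccontr)
  assume "\<not> ?thesis"
  then obtain s where s: "limsup (\<lambda>n. ereal (root n \<bar>b n\<bar>)) < s" "s < limsup (\<lambda>n. ereal (root n \<bar>a n\<bar>))"
    using dense not_le by metis
  have "0 \<le> limsup (\<lambda>n. ereal (root n \<bar>b n\<bar>))"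
    by (intro le_Limsup always_eventually allI) (auto simp: real_root_ge_zero)
  then have "0 < s" using s(1) by (rule order.strict_trans1)
  then obtain r where r: "s = ereal r" "0 < r"
    using s(2) by (cases s) auto
  have "\<forall>\<^sub>F n in sequentially. ereal (root n \<bar>b n\<bar>) < ereal r"
    using s(1) r by (intro Limsup_lessD) simp
  then have "\<forall>\<^sub>F n in sequentially. norm (b n) \<le> 1 * norm (r ^ n)"
    using eventually_gt_at_top[of 0]
  proof eventually_elim
    case (elim n)
    then have "root n \<bar>b n\<bar> ^ n \<le> r ^ n"
      by (intro power_mono) auto
    then show ?case using elim r by simp
  qed
  then have b: "b \<in> O(\<lambda>n. r ^ n)" by (rule bigoI)
  have "a \<in> O(\<lambda>n. r ^ n)"
  proof (cases "r < 1")
    case True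
    then show ?thesis using geometric b r by simp
  next
    case False
    then have "(\<lambda>_. 1) \<in> O(\<lambda>n. r ^ n)"
      by (intro bigoI[of _ 1] always_eventually allI) simp
    then show ?thesis using bounded landau_o.big_trans by blast
  qed
  then obtain K where K: "0 < K" "\<forall>\<^sub>F n in sequentially. norm (a n) \<le> K * norm (r ^ n)"
    by (rule landau_o.bigE)
  have "limsup (\<lambda>n. ereal (root n \<bar>a n\<bar>)) \<le> limsup (\<lambda>n. ereal (root n K * r))"
  proof (rule Limsup_mono)
    show "\<forall>\<^sub>F n in sequentially. ereal (root n \<bar>a n\<bar>) \<le> ereal (root n K * r)"
      using K(2) eventually_gt_at_top[of 0]
    proof eventually_elim
      case (elim n)
      then have "root n \<bar>a n\<bar> \<le> root n (K * r ^ n)"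
        using r by (intro real_root_le_mono) auto
      then show ?case using elim r by (simp add: real_root_mult real_root_power_cancel)
    qed
  qed
  also have "\<dots> = ereal r"
  proof (rule lim_imp_Limsup)
    have "(\<lambda>n. root n K * r) \<longlonglongrightarrow> 1 * r"
      using K by (intro tendsto_mult LIMSEQ_root_const) auto
    then show "(\<lambda>n. ereal (root n K * r)) \<longlonglongrightarrow> ereal r" by simp
  qed simp
  finally show False using s(2) r by simp
qed

theorem (in AR_covariance) limsup_root_reflection:
  "limsup (\<lambda>n. ereal (root n \<bar>\<phi> n n\<bar>)) = limsup (\<lambda>n. ereal (root n \<bar>\<pi> n\<bar>))"
proof (rule antisym; rule limsup_root_le_limsup_root)
  show "(\<lambda>n. \<phi> n n) \<in> O(\<lambda>_. 1)"
    by (rule bigoI[of _ "(1 + C) * tail 0"], rule eventually_mono[OF eventually_ge_at_top[of 1]])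
      (use levinson_bounded in auto)
  show "\<pi> \<in> O(\<lambda>_. 1)"
    by (rule bigoI[of _ "tail 0"], rule eventually_mono[OF eventually_ge_at_top[of 1]])
      (use coefficient_bounded in auto)
qed (use reflection_in_bigo coefficients_in_bigo in auto)

section \<open>The covariance of a causal invertible process\<close>

locale causal_invertible_process =
  fixes M :: "'a measure" and X \<epsilon> :: "int \<Rightarrow> 'a \<Rightarrow> real" and \<pi> \<psi> :: "nat \<Rightarrow> real" and v :: real
  assumes stationary: "zero_mean_weakly_stationary M X"
    and noise: "white_noise M \<epsilon> v"
    and v_pos: "0 < v"
    and AR: "AR_infinity M X \<epsilon> \<pi>"
    and MA: "MA_infinity M X \<epsilon> \<psi>"
begin

definition \<gamma> :: "int \<Rightarrow> real" where
  "\<gamma> k = inner2 M (X 0) (X k)"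

lemma X_L2: "X t \<in> L2 M"
  using stationary by (simp add: zero_mean_weakly_stationary_def)

lemma \<epsilon>_L2: "\<epsilon> t \<in> L2 M"
  using noise by (simp add: white_noise_def)

lemma covariance: "inner2 M (X s) (X t) = \<gamma> (s - t)"
proof -
  obtain g where g: "\<And>t k. inner2 M (X t) (X (t + k)) = g k"
    using stationary by (auto simp: zero_mean_weakly_stationary_def inner2_def)
  have "inner2 M (X s) (X t) = inner2 M (X t) (X s)" by (rule inner2_commute)
  also have "\<dots> = \<gamma> (s - t)"
    using g[of t "s - t"] g[of 0 "s - t"] by (simp add: \<gamma>_def)
  finally show ?thesis .
qed

lemma covariance_even: "\<gamma> (- k) = \<gamma> k"
  using covariance[of 0 k] covariance[of k 0] inner2_commute[of M "X 0" "X k"] by simp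

lemma noise_inner2: "inner2 M (\<epsilon> s) (\<epsilon> t) = (if s = t then v else 0)"
  using noise by (auto simp: white_noise_def inner2_def power2_eq_square)

lemma AR_inner2:
  assumes W: "W \<in> L2 M"
  shows "(\<lambda>l. \<pi> (Suc l) * inner2 M (X (t - int (Suc l))) W) sums (inner2 M (X t) W - inner2 M (\<epsilon> t) W)"
proof -
  have "(\<lambda>n. inner2 M (\<lambda>\<omega>. (\<Sum>i=1..n. \<pi> i * X (t - int i) \<omega>) + \<epsilon> t \<omega>) W) \<longlonglongrightarrow> inner2 M (X t) W"
    using AR by (intro ms_tendsto_inner2 W) (simp add: AR_infinity_def)
  moreover have "inner2 M (\<lambda>\<omega>. (\<Sum>i=1..n. \<pi> i * X (t - int i) \<omega>) + \<epsilon> t \<omega>) W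
      = (\<Sum>l<n. \<pi> (Suc l) * inner2 M (X (t - int (Suc l))) W) + inner2 M (\<epsilon> t) W" for n
  proof -
    have "(\<Sum>i=1..n. \<pi> i * inner2 M (X (t - int i)) W)
        = (\<Sum>l<n. \<pi> (Suc l) * inner2 M (X (t - int (Suc l))) W)"
      by (rule sum.reindex_bij_witness[where j = "\<lambda>j. j - 1" and i = Suc]) auto
    then show ?thesis
      by (simp add: inner2_add_left inner2_sum_left L2_sum X_L2 \<epsilon>_L2 W del: of_nat_Suc)
  qed
  ultimately have "(\<lambda>n. (\<Sum>l<n. \<pi> (Suc l) * inner2 M (X (t - int (Suc l))) W) + inner2 M (\<epsilon> t) W - inner2 M (\<epsilon> t) W)
      \<longlonglongrightarrow> inner2 M (X t) W - inner2 M (\<epsilon> t) W"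
    by (intro tendsto_diff) (simp_all del: of_nat_Suc)
  then show ?thesis by (simp add: sums_def del: of_nat_Suc)
qed

text \<open>
  This is the use of causality: \<open>X s\<close> is a limit of combinations of \<open>\<epsilon> s, \<epsilon> (s - 1), \<dots>\<close>.
\<close>

lemma noise_orthogonal_past:
  assumes "s < t"
  shows "inner2 M (X s) (\<epsilon> t) = 0"
proof -
  have "(\<lambda>n. inner2 M (\<lambda>\<omega>. \<epsilon> s \<omega> + (\<Sum>i=1..n. \<psi> i * \<epsilon> (s - int i) \<omega>)) (\<epsilon> t)) \<longlonglongrightarrow> inner2 M (X s) (\<epsilon> t)"
    using MA by (intro ms_tendsto_inner2 \<epsilon>_L2) (simp add: MA_infinity_def)
  moreover have "inner2 M (\<lambda>\<omega>. \<epsilon> s \<omega> + (\<Sum>i=1..n. \<psi> i * \<epsilon> (s - int i) \<omega>)) (\<epsilon> t) = 0" for n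
    using assms by (simp add: inner2_add_left inner2_sum_left L2_sum \<epsilon>_L2 noise_inner2)
  ultimately show ?thesis by (simp add: LIMSEQ_const_iff)
qed

definition comb :: "nat set \<Rightarrow> (nat \<Rightarrow> real) \<Rightarrow> int \<Rightarrow> 'a \<Rightarrow> real" where
  "comb F c s = (\<lambda>\<omega>. \<Sum>j\<in>F. c j * X (s - int j) \<omega>)"

lemma comb_L2: "comb F c s \<in> L2 M"
  unfolding comb_def by (intro L2_sum X_L2)

lemma inner2_comb_X: "inner2 M (comb F c s) (X t) = (\<Sum>j\<in>F. c j * \<gamma> (s - int j - t))"
  by (simp add: comb_def inner2_sum_left X_L2 covariance)

lemma inner2_comb_comb:
  "inner2 M (comb F c s) (comb F c s) = (\<Sum>i\<in>F. c i * (\<Sum>j\<in>F. c j * \<gamma> (int i - int j)))"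
proof -
  have "inner2 M (comb F c s) (comb F c s) = (\<Sum>i\<in>F. c i * inner2 M (comb F c s) (X (s - int i)))"
    using comb_L2[of F c s]
    by (subst (1) comb_def) (simp add: inner2_sum_left X_L2 inner2_commute[of M "X _" "comb F c s"])
  then show ?thesis by (simp add: inner2_comb_X algebra_simps)
qed

text \<open>One plus this sum bounds the norm of the operator that maps the process to the noise.\<close>

definition S :: real where
  "S = (\<Sum>l. \<bar>\<pi> (Suc l)\<bar>)"

lemma summable_\<pi>: "summable (\<lambda>l. \<bar>\<pi> (Suc l)\<bar>)"
  using AR by (simp add: AR_infinity_def)

lemma S_nonneg: "0 \<le> S"
  unfolding S_def by (rule suminf_nonneg[OF summable_\<pi>]) simp

text \<open>
  The combination \<open>U\<close> of the noise with coefficients \<open>c\<close> satisfies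
  \<open>U = Z 0 - (\<Sum>l\<ge>1. \<pi> l * Z l)\<close>, where \<open>Z l\<close> is the same combination of the process, shifted by \<open>l\<close>
  into the past. By stationarity all \<open>Z l\<close> have the norm \<open>sqrt Q\<close>, so the norm of \<open>U\<close>
  is at most \<open>(1 + S) * sqrt Q\<close>, while its square is \<open>v\<close> times the sum of the squares of \<open>c\<close>. The
  identity for \<open>U\<close> is used only in its inner product with \<open>U\<close>.
\<close>

lemma covariance_coercive:
  assumes F: "finite F"
  shows "v / (1 + S)\<^sup>2 * (\<Sum>i\<in>F. (c i)\<^sup>2) \<le> (\<Sum>i\<in>F. c i * (\<Sum>j\<in>F. c j * \<gamma> (int i - int j)))"
proof -
  define Q where "Q = (\<Sum>i\<in>F. c i * (\<Sum>j\<in>F. c j * \<gamma> (int i - int j)))"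
  define U where "U = (\<lambda>\<omega>. \<Sum>j\<in>F. c j * \<epsilon> (- int j) \<omega>)"
  have U: "U \<in> L2 M" unfolding U_def by (intro L2_sum \<epsilon>_L2)
  have Q: "norm2 M (comb F c s) = sqrt Q" for s
    by (simp add: norm2_def inner2_comb_comb Q_def)
  have Q0: "0 \<le> sqrt Q" using norm2_nonneg[of M "comb F c 0"] by (simp add: Q)
  have bound: "\<bar>inner2 M (comb F c s) U\<bar> \<le> sqrt Q * norm2 M U" for s
    using Cauchy_Schwarz_inner2[OF comb_L2 U, of F c s] by (simp add: Q)
  have innerU: "inner2 M (\<epsilon> (- int j)) U = c j * v" if "j \<in> F" for j
    using that F
    by (subst inner2_commute, subst U_def)
      (simp add: inner2_sum_left \<epsilon>_L2 noise_inner2 if_distrib sum.delta cong: if_cong)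
  have UU: "inner2 M U U = (\<Sum>j\<in>F. c j * inner2 M (\<epsilon> (- int j)) U)"
    using U by (subst (1) U_def) (simp add: inner2_sum_left \<epsilon>_L2)
  also have "\<dots> = v * (\<Sum>j\<in>F. (c j)\<^sup>2)"
    by (simp add: innerU sum_distrib_left power2_eq_square mult_ac)
  finally have U_norm: "inner2 M U U = v * (\<Sum>j\<in>F. (c j)\<^sup>2)" .
  have "(\<lambda>l. \<Sum>j\<in>F. c j * (\<pi> (Suc l) * inner2 M (X (- int j - int (Suc l))) U))
      sums (\<Sum>j\<in>F. c j * (inner2 M (X (- int j)) U - inner2 M (\<epsilon> (- int j)) U))"
    by (intro sums_sum sums_mult AR_inner2 U)
  moreover have "(\<Sum>j\<in>F. c j * (\<pi> (Suc l) * inner2 M (X (- int j - int (Suc l))) U))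
      = \<pi> (Suc l) * inner2 M (comb F c (- int (Suc l))) U" for l
    by (simp add: comb_def inner2_sum_left X_L2 U sum_distrib_left mult.left_commute
        minus_diff_commute[of "int (Suc l)"] del: of_nat_Suc)
  moreover have "(\<Sum>j\<in>F. c j * (inner2 M (X (- int j)) U - inner2 M (\<epsilon> (- int j)) U))
      = inner2 M (comb F c 0) U - inner2 M U U"
    by (simp add: UU comb_def inner2_sum_left X_L2 U right_diff_distrib sum_subtractf)
  ultimately have sums: "(\<lambda>l. - (\<pi> (Suc l) * inner2 M (comb F c (- int (Suc l))) U))
      sums (- (inner2 M (comb F c 0) U - inner2 M U U))"
    by (intro sums_minus) (simp del: of_nat_Suc)
  have "- (inner2 M (comb F c 0) U - inner2 M U U) \<le> S * (sqrt Q * norm2 M U)"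
  proof (rule sums_le[OF _ sums])
    show "(\<lambda>l. \<bar>\<pi> (Suc l)\<bar> * (sqrt Q * norm2 M U)) sums (S * (sqrt Q * norm2 M U))"
      unfolding S_def by (intro sums_mult2 summable_sums summable_\<pi>)
    fix l
    have "- (\<pi> (Suc l) * inner2 M (comb F c (- int (Suc l))) U)
        \<le> \<bar>\<pi> (Suc l)\<bar> * \<bar>inner2 M (comb F c (- int (Suc l))) U\<bar>"
      by (metis abs_ge_minus_self abs_mult)
    also have "\<dots> \<le> \<bar>\<pi> (Suc l)\<bar> * (sqrt Q * norm2 M U)"
      by (intro mult_left_mono bound) simp
    finally show "- (\<pi> (Suc l) * inner2 M (comb F c (- int (Suc l))) U)
        \<le> \<bar>\<pi> (Suc l)\<bar> * (sqrt Q * norm2 M U)" .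
  qed
  then have "norm2 M U * norm2 M U \<le> ((1 + S) * sqrt Q) * norm2 M U"
    using bound[of 0] norm2_square[of M U] by (simp add: algebra_simps power2_eq_square)
  then have "norm2 M U \<le> (1 + S) * sqrt Q"
    using norm2_nonneg[of M U] S_nonneg Q0
    by (cases "norm2 M U = 0") (auto simp: mult_le_cancel_right)
  then have "(norm2 M U)\<^sup>2 \<le> ((1 + S) * sqrt Q)\<^sup>2"
    by (rule power_mono) (rule norm2_nonneg)
  then have "v * (\<Sum>j\<in>F. (c j)\<^sup>2) \<le> (1 + S)\<^sup>2 * Q"
    using Q0 by (simp add: norm2_square U_norm power_mult_distrib)
  then show ?thesis
    using S_nonneg by (simp add: Q_def[symmetric] field_simps)
qed

sublocale AR_covariance \<gamma> "v / (1 + S)\<^sup>2" \<pi>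
proof
  show "0 < v / (1 + S)\<^sup>2" using v_pos S_nonneg by simp
  show "(\<lambda>l. \<pi> (Suc l) * \<gamma> (int i - int (Suc l))) sums \<gamma> (int i)" if "1 \<le> i" for i
    using AR_inner2[OF X_L2[of 0], of "int i"] noise_orthogonal_past[of 0 "int i"] that
    by (simp add: covariance inner2_commute[of M "\<epsilon> _" "X _"] del: of_nat_Suc)
  show "(\<Sum>i\<in>F. c i * \<gamma> (int i - int l))\<^sup>2
      \<le> \<gamma> 0 * (\<Sum>i\<in>F. c i * (\<Sum>j\<in>F. c j * \<gamma> (int i - int j)))" if "finite F" for F c l
  proof -
    have "inner2 M (comb F c 0) (X (- int l)) = (\<Sum>i\<in>F. c i * \<gamma> (int i - int l))"
    proof -
      have "\<gamma> (0 - int i - - int l) = \<gamma> (int i - int l)" for i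
        using covariance_even[of "int i - int l"] by simp
      then show ?thesis unfolding inner2_comb_X by simp
    qed
    then show ?thesis
      using Cauchy_Schwarz_inner2_square[OF comb_L2[of F c 0] X_L2[of "- int l"]]
      by (simp add: inner2_comb_comb covariance mult.commute)
  qed
qed (use covariance_even covariance_coercive summable_\<pi> in auto)

section \<open>Partial autocorrelations\<close>

lemma X_closed_span: "u \<in> I \<Longrightarrow> X u \<in> closed_span M X I"
proof -
  assume u: "u \<in> I"
  have "X u \<in> lin_span X I"
    unfolding lin_span_def using u
    by (intro CollectI exI[of _ "{u}"] exI[of _ "\<lambda>_. 1"]) auto
  moreover have "ms_tendsto M (\<lambda>_. X u) (X u)"
    by (simp add: ms_tendsto_def X_L2)
  ultimately show ?thesis by (auto simp: closed_span_def)
qed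

lemma orthogonal_closed_span:
  assumes R: "R \<in> L2 M" and orth: "\<And>u. u \<in> I \<Longrightarrow> inner2 M R (X u) = 0"
    and W: "W \<in> closed_span M X I"
  shows "inner2 M R W = 0"
proof -
  obtain Z where Z: "\<And>n. Z n \<in> lin_span X I" "ms_tendsto M Z W"
    using W by (auto simp: closed_span_def)
  have "inner2 M (Z n) R = 0" for n
  proof -
    obtain F c where F: "F \<subseteq> I" "Z n = (\<lambda>\<omega>. \<Sum>t\<in>F. c t * X t \<omega>)"
      using Z(1)[of n] by (auto simp: lin_span_def)
    then show ?thesis
      using orth by (auto simp: inner2_sum_left X_L2 R inner2_commute[of M "X _" R] intro!: sum.neutral)
  qed
  then have "inner2 M W R = 0"
    using ms_tendsto_inner2[OF Z(2) R] by (simp add: LIMSEQ_const_iff)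
  then show ?thesis by (simp add: inner2_commute)
qed

lemma comb_closed_span: "comb {1..k} c t \<in> closed_span M X {t - int k..t - 1}"
proof -
  have "comb {1..k} c t \<in> lin_span X {t - int k..t - 1}"
    unfolding lin_span_def
  proof (intro CollectI exI conjI)
    show "comb {1..k} c t = (\<lambda>\<omega>. \<Sum>u\<in>{t - int k..t - 1}. c (nat (t - u)) * X u \<omega>)"
      unfolding comb_def
      by (intro ext sum.reindex_bij_witness[where i = "\<lambda>u. nat (t - u)" and j = "\<lambda>j. t - int j"]) auto
  qed auto
  moreover have "ms_tendsto M (\<lambda>_. comb {1..k} c t) (comb {1..k} c t)"
    by (simp add: ms_tendsto_def comb_L2)
  ultimately show ?thesis unfolding closed_span_def
    by (intro CollectI exI[of _ "\<lambda>_. comb {1..k} c t"]) simp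
qed

lemma residual_inner2:
  "inner2 M (\<lambda>\<omega>. X t \<omega> - comb {1..k} c t \<omega>) (X (t - int i))
    = \<gamma> (int i) - (\<Sum>j=1..k. c j * \<gamma> (int i - int j))"
  by (simp add: inner2_diff_left X_L2 comb_L2 covariance inner2_comb_X)

text \<open>
  Orthogonality of the residual to the closed span is the same as orthogonality to the generators
  \<open>X (t - i)\<close>, which is row \<open>i\<close> of the normal equations and by stationarity does not involve \<open>t\<close>.
\<close>

lemma prediction_coeffs_iff: "prediction_coeffs M X k c \<longleftrightarrow> normal_equations k c"
proof
  assume "prediction_coeffs M X k c"
  then have "is_projection M X {0 - int k..0 - 1} (X 0) (comb {1..k} c 0)"
    unfolding prediction_coeffs_def comb_def by blast
  then have orth: "inner2 M (\<lambda>\<omega>. X 0 \<omega> - comb {1..k} c 0 \<omega>) W = 0"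
    if "W \<in> closed_span M X {0 - int k..0 - 1}" for W
    using that unfolding is_projection_def inner2_def by blast
  show "normal_equations k c"
    unfolding normal_equations_def
  proof
    fix i assume "i \<in> {1..k}"
    then have "inner2 M (\<lambda>\<omega>. X 0 \<omega> - comb {1..k} c 0 \<omega>) (X (0 - int i)) = 0"
      by (intro orth X_closed_span) auto
    then show "(\<Sum>j=1..k. c j * \<gamma> (int i - int j)) = \<gamma> (int i)"
      unfolding residual_inner2 by simp
  qed
next
  assume ne: "normal_equations k c"
  have "is_projection M X {t - int k..t - 1} (X t) (comb {1..k} c t)" for t
    unfolding is_projection_def
  proof (intro conjI ballI comb_closed_span)
    fix W assume "W \<in> closed_span M X {t - int k..t - 1}"
    then have "inner2 M (\<lambda>\<omega>. X t \<omega> - comb {1..k} c t \<omega>) W = 0"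
    proof (rule orthogonal_closed_span[rotated 2])
      fix u assume "u \<in> {t - int k..t - 1}"
      then have "u = t - int (nat (t - u))" "nat (t - u) \<in> {1..k}" by auto
      then obtain i where "u = t - int i" "i \<in> {1..k}" by blast
      then show "inner2 M (\<lambda>\<omega>. X t \<omega> - comb {1..k} c t \<omega>) (X u) = 0"
        using residual_inner2[of t k c i] ne by (simp add: normal_equations_def)
    qed (intro L2_diff X_L2 comb_L2)
    then show "(\<integral>\<omega>. (X t \<omega> - comb {1..k} c t \<omega>) * W \<omega> \<partial>M) = 0"
      by (simp add: inner2_def)
  qed
  then show "prediction_coeffs M X k c"
    unfolding prediction_coeffs_def comb_def by blast
qed

lemma pacf_eq_levinson:
  assumes "1 \<le> k"
  shows "pacf M X k = levinson \<gamma> k k"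
  unfolding pacf_def prediction_coeffs_iff
proof (rule the_equality)
  show "\<exists>c. normal_equations k c \<and> c k = levinson \<gamma> k k"
    using levinson_normal_equations by blast
  show "a = levinson \<gamma> k k" if "\<exists>c. normal_equations k c \<and> c k = a" for a
    using that normal_equations_unique[OF _ levinson_normal_equations] assms by auto
qed

end

theorem theorem2p1:
  fixes M :: "'a measure"
    and X \<epsilon> :: "int \<Rightarrow> 'a \<Rightarrow> real"
    and \<pi> \<psi> :: "nat \<Rightarrow> real"
    and \<sigma> :: real
  assumes "prob_space M"
    and "zero_mean_weakly_stationary M X"
    and "white_noise M \<epsilon> (\<sigma>\<^sup>2)"
    and "\<sigma>\<^sup>2 > 0"
    and "AR_infinity M X \<epsilon> \<pi>"
    and "MA_infinity M X \<epsilon> \<psi>"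
  shows "limsup (\<lambda>n. ereal (root n \<bar>pacf M X n\<bar>)) = limsup (\<lambda>n. ereal (root n \<bar>\<pi> n\<bar>))"
proof -
  interpret causal_invertible_process M X \<epsilon> \<pi> \<psi> "\<sigma>\<^sup>2"
    using assms by unfold_locales auto
  \<comment> \<open>At 0 the partial autocorrelation is not determined, but a single term does not affect the upper limit.\<close>
  have "limsup (\<lambda>n. ereal (root n \<bar>pacf M X n\<bar>)) = limsup (\<lambda>n. ereal (root n \<bar>levinson \<gamma> n n\<bar>))"
    by (rule Limsup_eq, rule eventually_mono[OF eventually_ge_at_top[of 1]])
      (simp add: pacf_eq_levinson)
  then show ?thesis using limsup_root_reflection by simp
qed

end
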